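(* For every nested sequent $\Gamma$, $\Gamma$ is derivable in $\mathbf{SS5}$ if and only if $\Gamma$ is derivable in $\mathbf{DS5}$.
   Context: Formulae are in negation normal form over $a,\neg a,\lor,\land,\square,\blacksquare,\lozenge,\lozenge^{\bullet}$ ($\lozenge^{\bullet}$ the past diamond, dual of $\blacksquare$). Nested sequents are multisets of formulae and structures $\circ\{\Gamma\}$, $\bullet\{\Delta\}$; $\Sigma[\,]$ is a context with a hole at any depth. $\mathbf{SKt}$: $id$ ($\Gamma,a,\overline a$), $cut$, $\land$, $\lor$, $ctr$, $wk$, $rf$ (from $\Gamma,\circ\{\Delta\}$ infer $\bullet\{\Gamma\},\Delta$), $rp$ (from $\Gamma,\bullet\{\Delta\}$ infer $\circ\{\Gamma\},\Delta$), $\blacksquare$ (from $\Gamma,\bullet\{A\}$ infer $\Gamma,\blacksquare A$), $\square$ (from $\Gamma,\circ\{A\}$ infer $\Gamma,\square A$), $\lozenge^{\bullet}$ (from $\Gamma,\bullet\{\Delta,A\}$ infer $\Gamma,\bullet\{\Delta\},\lozenge^{\bullet}A$), $\lozenge$ (from $\Gamma,\circ\{\Delta,A\}$ infer $\Gamma,\circ\{\Delta\},\lozenge A$). $\mathbf{SS5}$ is $\mathbf{SKt}$ plus $T_f$ (from $\Gamma,\circ\{\Delta\}$ infer $\Gamma,\Delta$), $4_f$ (from $\Gamma,\circ\{\Delta\}$ infer $\Gamma,\circ\{\circ\{\Delta\}\}$) and $B$ (from $\Gamma,\bullet\{\Delta\}$ infer $\Gamma,\circ\{\Delta\}$). $\mathbf{DKt}$: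 $id$: $\Sigma[a,\overline a]$; $\land$; $\lor$; $\blacksquare$: from $\Sigma[\blacksquare A,\bullet\{A\}]$ infer $\Sigma[\blacksquare A]$; $\square$: from $\Sigma[\square A,\circ\{A\}]$ infer $\Sigma[\square A]$; $\lozenge^{\bullet}_1$: from $\Sigma[\bullet\{\Delta,A\},\lozenge^{\bullet}A]$ infer $\Sigma[\bullet\{\Delta\},\lozenge^{\bullet}A]$; $\lozenge^{\bullet}_2$: from $\Sigma[\circ\{\Delta,\lozenge^{\bullet}A\},A]$ infer $\Sigma[\circ\{\Delta,\lozenge^{\bullet}A\}]$; $\lozenge_1$: from $\Sigma[\circ\{\Delta,A\},\lozenge A]$ infer $\Sigma[\circ\{\Delta\},\lozenge A]$; $\lozenge_2$: from $\Sigma[\bullet\{\Delta,\lozenge A\},A]$ infer $\Sigma[\bullet\{\Delta,\lozenge A\}]$ (where $\land,\lor$ keep the principal formula: from $\Sigma[A\land B,A]$, $\Sigma[A\land B,B]$ infer $\Sigma[A\land B]$; from $\Sigma[A\lor B,A,B]$ infer $\Sigma[A\lor B]$). $\mathbf{DS5}$ is $\mathbf{DKt}$ plus: $T_a$: from $\Sigma[\lozenge^{\bullet}A,A]$ infer $\Sigma[\lozenge^{\bullet}A]$; $T_b$: from $\Sigma[\lozenge A,A]$ infer $\Sigma[\lozenge A]$; $4_a$: from $\Sigma[\lozenge^{\bullet}A,\bullet\{\lozenge^{\bullet}A,\Delta\}]$ infer $\Sigma[\lozenge^{\bullet}A,\bullet\{\Delta\}]$; $4_b$: from $\Sigma[\circ\{\Delta,\lozenge^{\bullet}A\},\lozenge^{\bullet}A]$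 infer $\Sigma[\circ\{\Delta,\lozenge^{\bullet}A\}]$; $4_c$: from $\Sigma[\lozenge A,\circ\{\lozenge A,\Delta\}]$ infer $\Sigma[\lozenge A,\circ\{\Delta\}]$; $4_d$: from $\Sigma[\bullet\{\Delta,\lozenge A\},\lozenge A]$ infer $\Sigma[\bullet\{\Delta,\lozenge A\}]$; $5_a$: from $\Sigma[\lozenge^{\bullet}A,\circ\{\lozenge^{\bullet}A,\Delta\}]$ infer $\Sigma[\lozenge^{\bullet}A,\circ\{\Delta\}]$; $5_b$: from $\Sigma[\circ\{\Delta,\lozenge A\},\lozenge A]$ infer $\Sigma[\circ\{\Delta,\lozenge A\}]$; $5_c$: from $\Sigma[\lozenge A,\bullet\{\lozenge A,\Delta\}]$ infer $\Sigma[\lozenge A,\bullet\{\Delta\}]$; $5_d$: from $\Sigma[\bullet\{\Delta,\lozenge^{\bullet}A\},\lozenge^{\bullet}A]$ infer $\Sigma[\bullet\{\Delta,\lozenge^{\bullet}A\}]$. *)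

theory Defs
  imports Main "HOL-Library.Multiset"
begin

text \<open>Tense formulae in negation normal form. \<open>BBox\<close> and \<open>BDia\<close> are the past modalities
  (black box and black diamond).\<close>

datatype 'a fm =
    Atom 'a
  | NAtom 'a
  | Or "'a fm" "'a fm"
  | And "'a fm" "'a fm"
  | Box "'a fm"
  | BBox "'a fm"
  | Dia "'a fm"
  | BDia "'a fm"

primrec dual :: "'a fm \<Rightarrow> 'a fm" where
  "dual (Atom a) = NAtom a"
| "dual (NAtom a) = Atom a"
| "dual (Or A B) = And (dual A) (dual B)"
| "dual (And A B) = Or (dual A) (dual B)"
| "dual (Box A) = Dia (dual A)"
| "dual (BBox A) = BDia (dual A)"
| "dual (Dia A) = Box (dual A)"
| "dual (BDia A) = BBox (dual A)"

text \<open>\<open>White \<Delta>\<close> is the structure $\circ\{\Delta\}$ and \<open>Black \<Delta>\<close> is $\bullet\{\Delta\}$.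
  The multiset inside may be empty.\<close>

datatype 'a struct =
    Form "'a fm"
  | White "'a struct multiset"
  | Black "'a struct multiset"

type_synonym 'a sequent = "'a struct multiset"

text \<open>A context has exactly one hole. The multiset argument is the material beside the hole,
  respectively beside the structure that contains the hole.\<close>

datatype 'a ctx =
    Hole "'a sequent"
  | CWhite "'a sequent" "'a ctx"
  | CBlack "'a sequent" "'a ctx"

primrec fill :: "'a ctx \<Rightarrow> 'a sequent \<Rightarrow> 'a sequent" where
  "fill (Hole \<Gamma>) \<Delta> = \<Gamma> + \<Delta>"
| "fill (CWhite \<Gamma> \<Sigma>) \<Delta> = \<Gamma> + {#White (fill \<Sigma> \<Delta>)#}"
| "fill (CBlack \<Gamma> \<Sigma>) \<Delta> = \<Gamma> + {#Black (fill \<Sigma> \<Delta>)#}"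

text \<open>A calculus is given by its rule instances, a relation between the list of premises and
  the conclusion.\<close>

type_synonym 'a calculus = "'a sequent list \<Rightarrow> 'a sequent \<Rightarrow> bool"

inductive derivable :: "'a calculus \<Rightarrow> 'a sequent \<Rightarrow> bool" for R :: "'a calculus" where
  "R ps \<Gamma> \<Longrightarrow> (\<And>\<Delta>. \<Delta> \<in> set ps \<Longrightarrow> derivable R \<Delta>) \<Longrightarrow> derivable R \<Gamma>"

inductive SKt :: "'a calculus" where
  id: "SKt [] (\<Gamma> + {#Form (Atom a), Form (NAtom a)#})"
| cut: "SKt [\<Gamma> + {#Form A#}, \<Delta> + {#Form (dual A)#}] (\<Gamma> + \<Delta>)"
| conj: "SKt [\<Gamma> + {#Form A#}, \<Gamma> + {#Form B#}] (\<Gamma> + {#Form (And A B)#})"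
| disj: "SKt [\<Gamma> + {#Form A, Form B#}] (\<Gamma> + {#Form (Or A B)#})"
| ctr: "SKt [\<Gamma> + \<Delta> + \<Delta>] (\<Gamma> + \<Delta>)"
| wk: "SKt [\<Gamma>] (\<Gamma> + \<Delta>)"
| rf: "SKt [\<Gamma> + {#White \<Delta>#}] ({#Black \<Gamma>#} + \<Delta>)"
| rp: "SKt [\<Gamma> + {#Black \<Delta>#}] ({#White \<Gamma>#} + \<Delta>)"
| bbox: "SKt [\<Gamma> + {#Black {#Form A#}#}] (\<Gamma> + {#Form (BBox A)#})"
| box: "SKt [\<Gamma> + {#White {#Form A#}#}] (\<Gamma> + {#Form (Box A)#})"
| bdia: "SKt [\<Gamma> + {#Black (\<Delta> + {#Form A#})#}] (\<Gamma> + {#Black \<Delta>, Form (BDia A)#})"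
| dia: "SKt [\<Gamma> + {#White (\<Delta> + {#Form A#})#}] (\<Gamma> + {#White \<Delta>, Form (Dia A)#})"

inductive SS5 :: "'a calculus" where
  SKt: "SKt ps \<Gamma> \<Longrightarrow> SS5 ps \<Gamma>"
| Tf: "SS5 [\<Gamma> + {#White \<Delta>#}] (\<Gamma> + \<Delta>)"
| Four_f: "SS5 [\<Gamma> + {#White \<Delta>#}] (\<Gamma> + {#White {#White \<Delta>#}#})"
| B: "SS5 [\<Gamma> + {#Black \<Delta>#}] (\<Gamma> + {#White \<Delta>#})"

inductive DKt :: "'a calculus" where
  id: "DKt [] (fill \<Sigma> {#Form (Atom a), Form (NAtom a)#})"
| conj: "DKt [fill \<Sigma> {#Form (And A B), Form A#}, fill \<Sigma> {#Form (And A B), Form B#}]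
    (fill \<Sigma> {#Form (And A B)#})"
| disj: "DKt [fill \<Sigma> {#Form (Or A B), Form A, Form B#}] (fill \<Sigma> {#Form (Or A B)#})"
| bbox: "DKt [fill \<Sigma> {#Form (BBox A), Black {#Form A#}#}] (fill \<Sigma> {#Form (BBox A)#})"
| box: "DKt [fill \<Sigma> {#Form (Box A), White {#Form A#}#}] (fill \<Sigma> {#Form (Box A)#})"
| bdia1: "DKt [fill \<Sigma> {#Black (\<Delta> + {#Form A#}), Form (BDia A)#}]
    (fill \<Sigma> {#Black \<Delta>, Form (BDia A)#})"
| bdia2: "DKt [fill \<Sigma> {#White (\<Delta> + {#Form (BDia A)#}), Form A#}]
    (fill \<Sigma> {#White (\<Delta> + {#Form (BDia A)#})#})"
| dia1: "DKt [fill \<Sigma> {#White (\<Delta> + {#Form A#}), Form (Dia A)#}]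
    (fill \<Sigma> {#White \<Delta>, Form (Dia A)#})"
| dia2: "DKt [fill \<Sigma> {#Black (\<Delta> + {#Form (Dia A)#}), Form A#}]
    (fill \<Sigma> {#Black (\<Delta> + {#Form (Dia A)#})#})"

inductive DS5 :: "'a calculus" where
  DKt: "DKt ps \<Gamma> \<Longrightarrow> DS5 ps \<Gamma>"
| Ta: "DS5 [fill \<Sigma> {#Form (BDia A), Form A#}] (fill \<Sigma> {#Form (BDia A)#})"
| Tb: "DS5 [fill \<Sigma> {#Form (Dia A), Form A#}] (fill \<Sigma> {#Form (Dia A)#})"
| Four_a: "DS5 [fill \<Sigma> {#Form (BDia A), Black ({#Form (BDia A)#} + \<Delta>)#}]
    (fill \<Sigma> {#Form (BDia A), Black \<Delta>#})"
| Four_b: "DS5 [fill \<Sigma> {#White (\<Delta> + {#Form (BDia A)#}), Form (BDia A)#}]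
    (fill \<Sigma> {#White (\<Delta> + {#Form (BDia A)#})#})"
| Four_c: "DS5 [fill \<Sigma> {#Form (Dia A), White ({#Form (Dia A)#} + \<Delta>)#}]
    (fill \<Sigma> {#Form (Dia A), White \<Delta>#})"
| Four_d: "DS5 [fill \<Sigma> {#Black (\<Delta> + {#Form (Dia A)#}), Form (Dia A)#}]
    (fill \<Sigma> {#Black (\<Delta> + {#Form (Dia A)#})#})"
| Five_a: "DS5 [fill \<Sigma> {#Form (BDia A), White ({#Form (BDia A)#} + \<Delta>)#}]
    (fill \<Sigma> {#Form (BDia A), White \<Delta>#})"
| Five_b: "DS5 [fill \<Sigma> {#White (\<Delta> + {#Form (Dia A)#}), Form (Dia A)#}]
    (fill \<Sigma> {#White (\<Delta> + {#Form (Dia A)#})#})"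
| Five_c: "DS5 [fill \<Sigma> {#Form (Dia A), Black ({#Form (Dia A)#} + \<Delta>)#}]
    (fill \<Sigma> {#Form (Dia A), Black \<Delta>#})"
| Five_d: "DS5 [fill \<Sigma> {#Black (\<Delta> + {#Form (BDia A)#}), Form (BDia A)#}]
    (fill \<Sigma> {#Black (\<Delta> + {#Form (BDia A)#})#})"

end

theory Submission
  imports Defs
begin

text \<open>Semantically, S5 is the logic of universal frames, in which both colours of modality mean
  the same; we take a model to be a set of valuations. Every rule of \<open>SS5\<close> preserves validity.
  Conversely, backward proof search in \<open>DS5\<close> on a valid sequent succeeds: if a box is only expanded
  when its body labels no node of the tree yet, then the search terminates, and the nodes of a
  saturated tree that is no axiom form a countermodel, because the rules \<open>4\<close> and \<open>5\<close> carry every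
  diamond to every node. For the other inclusion, \<open>rf\<close> and \<open>rp\<close> bring any node of a nested sequent
  to the root, where the deep rules follow from the shallow ones and cut.\<close>

lemma derivable_nullary: "R [] Q \<Longrightarrow> derivable R Q"
  by (erule derivable.intros) simp

lemma derivable_unary: "R [P] Q \<Longrightarrow> derivable R P \<Longrightarrow> derivable R Q"
  by (erule derivable.intros) simp

lemma derivable_binary:
  "R [P, P'] Q \<Longrightarrow> derivable R P \<Longrightarrow> derivable R P' \<Longrightarrow> derivable R Q"
  by (erule derivable.intros) auto

section \<open>Simulation of the deep calculus\<close>

lemmas SS5_nullary = derivable_nullary[where R = SS5]
lemmas SS5_unary = derivable_unary[where R = SS5]
lemmas SS5_binary = derivable_binary[where R = SS5]

lemma SS5_cut:
  "derivable SS5 (\<Gamma> + {#Form A#}) \<Longrightarrow> derivable SS5 (\<Delta> + {#Form (dual A)#}) \<Longrightarrow>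
    derivable SS5 (\<Gamma> + \<Delta>)"
  by (rule SS5_binary[OF SS5.SKt[OF SKt.cut]])

lemma SS5_wk: "derivable SS5 \<Gamma> \<Longrightarrow> derivable SS5 (\<Gamma> + \<Delta>)"
  by (rule SS5_unary[OF SS5.SKt[OF SKt.wk]])

lemma SS5_ctr: "derivable SS5 (\<Gamma> + \<Delta> + \<Delta>) \<Longrightarrow> derivable SS5 (\<Gamma> + \<Delta>)"
  by (rule SS5_unary[OF SS5.SKt[OF SKt.ctr]])

text \<open>\<open>rf\<close> and \<open>rp\<close> undo each other: they make a child the root and
  turn the old root into its child, of the other colour.\<close>

lemma SS5_display_White:
  "derivable SS5 (\<Gamma> + {#White \<Delta>#}) \<longleftrightarrow> derivable SS5 (\<Delta> + {#Black \<Gamma>#})"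
  using SS5_unary[OF SS5.SKt[OF SKt.rf], of \<Gamma> \<Delta>]
    SS5_unary[OF SS5.SKt[OF SKt.rp], of \<Delta> \<Gamma>]
  by (auto simp: ac_simps add_mset_commute)

text \<open>\<open>B\<close> turns black into white. For the converse, exchange root and child,
  apply \<open>B\<close> to the new black child, and exchange back: the old child returns
  black.\<close>

lemma SS5_White_Black:
  "derivable SS5 (\<Gamma> + {#White \<Delta>#}) \<longleftrightarrow> derivable SS5 (\<Gamma> + {#Black \<Delta>#})"
  using SS5_display_White SS5_unary[OF SS5.B] by metis

text \<open>\<open>Four_f\<close> yields two white layers. The outer one changes colour at the root;
  the inner one does so after display has brought it there.\<close>

lemma SS5_Four:
  assumes "derivable SS5 (\<Gamma> + {#White \<Delta>#})"
    and "c \<in> {White, Black}" "d \<in> {White, Black}"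
  shows "derivable SS5 (\<Gamma> + {#c {#d \<Delta>#}#})"
proof -
  have *: "derivable SS5 (\<Gamma> + {#White {#White \<Delta>#}#})"
    by (rule SS5_unary[OF SS5.Four_f assms(1)])
  then have "derivable SS5 ({#Black \<Gamma>#} + {#White \<Delta>#})"
    by (simp only: SS5_display_White[of \<Gamma>] add.commute)
  then have "derivable SS5 ({#Black \<Delta>#} + {#Black \<Gamma>#})"
    by (simp only: SS5_White_Black ac_simps add_mset_commute)
  then have "derivable SS5 (\<Gamma> + {#White {#Black \<Delta>#}#})"
    by (simp only: SS5_display_White)
  with * show ?thesis
    using assms(2,3) SS5_White_Black by blast
qed

text \<open>Weakening adds an empty white structure, and displaying its content encloses the whole
  sequent with nothing left beside it.\<close>

lemma SS5_nec:
  assumes "derivable SS5 \<Gamma>"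
  shows "derivable SS5 {#White \<Gamma>#}" and "derivable SS5 {#Black \<Gamma>#}"
proof -
  have "derivable SS5 ({#} + {#Black \<Gamma>#})"
    using SS5_wk[OF assms, of "{#White {#}#}"] SS5_display_White by blast
  then show "derivable SS5 {#White \<Gamma>#}" "derivable SS5 {#Black \<Gamma>#}"
    using SS5_White_Black[of "{#}" \<Gamma>] by simp_all
qed

text \<open>\<open>SKt.id\<close> has atoms only, whereas the transitivity sequents used in cuts
  start from identities of arbitrary formulas.\<close>

lemma SS5_identity: "derivable SS5 {#Form A, Form (dual A)#}"
proof -
  have dia: "derivable SS5 {#Form (Dia A), Form (Box B)#}"
    "derivable SS5 {#Form (BDia A), Form (BBox B)#}"
    if AB: "derivable SS5 {#Form A, Form B#}" for A B :: "'a fm"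
  proof -
    from AB have AB': "derivable SS5 ({#Form B#} + {#Form A#})"
      by (simp add: ac_simps add_mset_commute)
    \<comment> \<open>Necessitation encloses \<open>B\<close> and \<open>A\<close>; the diamond rule
      takes \<open>A\<close> out and the box rule consumes the rest.\<close>
    have "derivable SS5 ({#} + {#White {#Form B#}, Form (Dia A)#})"
      by (rule SS5_unary[OF SS5.SKt[OF SKt.dia]]) (use SS5_nec(1)[OF AB'] in simp)
    then have "derivable SS5 ({#Form (Dia A)#} + {#White {#Form B#}#})"
      by (simp add: ac_simps add_mset_commute)
    from SS5_unary[OF SS5.SKt[OF SKt.box] this]
    show "derivable SS5 {#Form (Dia A), Form (Box B)#}"
      by (simp add: ac_simps add_mset_commute)
    have "derivable SS5 ({#} + {#Black {#Form B#}, Form (BDia A)#})"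
      by (rule SS5_unary[OF SS5.SKt[OF SKt.bdia]]) (use SS5_nec(2)[OF AB'] in simp)
    then have "derivable SS5 ({#Form (BDia A)#} + {#Black {#Form B#}#})"
      by (simp add: ac_simps add_mset_commute)
    from SS5_unary[OF SS5.SKt[OF SKt.bbox] this]
    show "derivable SS5 {#Form (BDia A), Form (BBox B)#}"
      by (simp add: ac_simps add_mset_commute)
  qed
  have or: "derivable SS5 {#Form (Or A B), Form (And A' B')#}"
    if A: "derivable SS5 {#Form A, Form A'#}" and B: "derivable SS5 {#Form B, Form B'#}"
    for A B A' B' :: "'a fm"
  proof -
    have "derivable SS5 ({#Form A, Form B#} + {#Form (And A' B')#})"
      by (rule SS5_binary[OF SS5.SKt[OF SKt.conj]])
        (use SS5_wk[OF A, of "{#Form B#}"] SS5_wk[OF B, of "{#Form A#}"] in \<open>simp_all add: ac_simps add_mset_commute\<close>)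
    then have "derivable SS5 ({#Form (And A' B')#} + {#Form A, Form B#})"
      by (simp add: ac_simps add_mset_commute)
    from SS5_unary[OF SS5.SKt[OF SKt.disj] this] show ?thesis
      by (simp add: ac_simps add_mset_commute)
  qed
  have id: "derivable SS5 {#Form (Atom a), Form (NAtom a)#}" for a :: 'a
    using SS5_nullary[OF SS5.SKt[OF SKt.id[of "{#}"]]] by simp
  have sym: "derivable SS5 {#s, t#} \<Longrightarrow> derivable SS5 {#t, s#}" for s t :: "'a struct"
    by (simp add: add_mset_commute)
  show ?thesis
    \<comment> \<open>\<open>dual\<close> exchanges the connectives of a pair, so one fact serves
      both cases once the two formulas are swapped by \<open>sym\<close>.\<close>
    by (induction A)
      (simp_all, blast intro: id, blast intro: id[THEN sym], blast intro: or,
        blast intro: sym or, (blast intro: sym dia)+)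
qed

text \<open>Necessitation encloses \<Gamma> and \<open>A\<close>, the diamond rule takes
  \<open>A\<close> out, and \<open>Tf\<close> opens the structure around \<Gamma>.\<close>

lemma SS5_diamond_free:
  assumes "derivable SS5 (\<Gamma> + {#Form A#})"
  shows "derivable SS5 (\<Gamma> + {#Form (Dia A)#})" and "derivable SS5 (\<Gamma> + {#Form (BDia A)#})"
proof -
  have "derivable SS5 ({#} + {#White \<Gamma>, Form (Dia A)#})"
    by (rule SS5_unary[OF SS5.SKt[OF SKt.dia]]) (use SS5_nec(1)[OF assms] in simp)
  then have "derivable SS5 ({#Form (Dia A)#} + {#White \<Gamma>#})"
    by (simp add: ac_simps add_mset_commute)
  from SS5_unary[OF SS5.Tf this] show "derivable SS5 (\<Gamma> + {#Form (Dia A)#})"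
    by (simp add: ac_simps add_mset_commute)
  have "derivable SS5 ({#} + {#Black \<Gamma>, Form (BDia A)#})"
    by (rule SS5_unary[OF SS5.SKt[OF SKt.bdia]]) (use SS5_nec(2)[OF assms] in simp)
  then have "derivable SS5 ({#Form (BDia A)#} + {#White \<Gamma>#})"
    by (simp only: SS5_White_Black) (simp add: add_mset_commute)
  from SS5_unary[OF SS5.Tf this] show "derivable SS5 (\<Gamma> + {#Form (BDia A)#})"
    by (simp add: ac_simps add_mset_commute)
qed

section \<open>Diamond rules with contraction, and transitivity\<close>

lemma SS5_add_Dia:
  assumes "derivable SS5 (\<Gamma> + {#White (\<Delta> + {#Form A#}), Form (Dia A)#})"
  shows "derivable SS5 (\<Gamma> + {#White \<Delta>, Form (Dia A)#})"
proof -
  have "derivable SS5 ((\<Gamma> + {#Form (Dia A)#}) + {#White \<Delta>, Form (Dia A)#})"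
    by (rule SS5_unary[OF SS5.SKt[OF SKt.dia]]) (use assms in \<open>simp add: ac_simps add_mset_commute\<close>)
  then show ?thesis
    using SS5_ctr[of "\<Gamma> + {#White \<Delta>#}" "{#Form (Dia A)#}"] by (simp add: ac_simps add_mset_commute)
qed

lemma SS5_add_BDia:
  assumes "derivable SS5 (\<Gamma> + {#Black (\<Delta> + {#Form A#}), Form (BDia A)#})"
  shows "derivable SS5 (\<Gamma> + {#Black \<Delta>, Form (BDia A)#})"
proof -
  have "derivable SS5 ((\<Gamma> + {#Form (BDia A)#}) + {#Black \<Delta>, Form (BDia A)#})"
    by (rule SS5_unary[OF SS5.SKt[OF SKt.bdia]]) (use assms in \<open>simp add: ac_simps add_mset_commute\<close>)
  then show ?thesis
    using SS5_ctr[of "\<Gamma> + {#Black \<Delta>#}" "{#Form (BDia A)#}"] by (simp add: ac_simps add_mset_commute)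
qed

lemma SS5_Box: "derivable SS5 (\<Gamma> + {#White {#Form A#}#}) \<Longrightarrow> derivable SS5 (\<Gamma> + {#Form (Box A)#})"
  by (rule SS5_unary[OF SS5.SKt[OF SKt.box]])

lemma SS5_BBox: "derivable SS5 (\<Gamma> + {#Black {#Form A#}#}) \<Longrightarrow> derivable SS5 (\<Gamma> + {#Form (BBox A)#})"
  by (rule SS5_unary[OF SS5.SKt[OF SKt.bbox]])

text \<open>The box rule acts at the root only. The outer structure is made white so that
  \<open>SS5_display_White\<close> can bring its content there and back.\<close>

lemma SS5_Box_in:
  assumes "derivable SS5 (\<Gamma> + {#c {#White {#Form A#}#}#})" "c \<in> {White, Black}"
  shows "derivable SS5 (\<Gamma> + {#c {#Form (Box A)#}#})"
proof -
  have "derivable SS5 (\<Gamma> + {#White {#White {#Form A#}#}#})"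
    using assms SS5_White_Black by blast
  then have "derivable SS5 ({#Black \<Gamma>#} + {#White {#Form A#}#})"
    by (simp only: SS5_display_White[of \<Gamma>] add.commute)
  then have "derivable SS5 ({#Form (Box A)#} + {#Black \<Gamma>#})"
    using SS5_Box by (metis add.commute)
  then have "derivable SS5 (\<Gamma> + {#White {#Form (Box A)#}#})"
    by (simp only: SS5_display_White)
  then show ?thesis
    using assms SS5_White_Black by blast
qed

lemma SS5_BBox_in:
  assumes "derivable SS5 (\<Gamma> + {#c {#Black {#Form A#}#}#})" "c \<in> {White, Black}"
  shows "derivable SS5 (\<Gamma> + {#c {#Form (BBox A)#}#})"
proof -
  have "derivable SS5 (\<Gamma> + {#White {#Black {#Form A#}#}#})"
    using assms SS5_White_Black by blast
  then have "derivable SS5 ({#Black \<Gamma>#} + {#Black {#Form A#}#})"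
    by (simp only: SS5_display_White[of \<Gamma>] add.commute)
  then have "derivable SS5 ({#Form (BBox A)#} + {#Black \<Gamma>#})"
    using SS5_BBox by (metis add.commute)
  then have "derivable SS5 (\<Gamma> + {#White {#Form (BBox A)#}#})"
    by (simp only: SS5_display_White)
  then show ?thesis
    using assms SS5_White_Black by blast
qed

lemma SS5_diamond_White:
  "derivable SS5 ({#Form (Dia A)#} + {#White {#Form (dual A)#}#})"
  "derivable SS5 ({#Form (BDia A)#} + {#White {#Form (dual A)#}#})"
proof -
  have *: "derivable SS5 ({#Form (dual A)#} + {#Form A#})"
    using SS5_identity[of A] by (simp add: ac_simps add_mset_commute)
  have "derivable SS5 ({#} + {#White {#Form (dual A)#}, Form (Dia A)#})"
    by (rule SS5_unary[OF SS5.SKt[OF SKt.dia]]) (use SS5_nec(1)[OF *] in simp)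
  then show "derivable SS5 ({#Form (Dia A)#} + {#White {#Form (dual A)#}#})"
    by (simp add: ac_simps add_mset_commute)
  have "derivable SS5 ({#} + {#Black {#Form (dual A)#}, Form (BDia A)#})"
    by (rule SS5_unary[OF SS5.SKt[OF SKt.bdia]]) (use SS5_nec(2)[OF *] in simp)
  then show "derivable SS5 ({#Form (BDia A)#} + {#White {#Form (dual A)#}#})"
    by (simp only: SS5_White_Black) (simp add: add_mset_commute)
qed

text \<open>Axiom 4 in all colours: a diamond in front of \<open>F\<close> implies \<open>F\<close>.
  \<open>SS5_Four\<close> splits the structure around \<open>dual A\<close> into two layers; the
  inner one closes to \<open>dual F\<close>, the outer one to the box in front of it.\<close>

lemma SS5_transitivity:
  assumes "F \<in> {Dia A, BDia A}"
  shows "derivable SS5 {#Form F, Form (dual (Dia F))#}"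
    and "derivable SS5 {#Form F, Form (dual (BDia F))#}"
proof -
  have *: "derivable SS5 ({#Form F#} + {#c {#Form (dual F)#}#})" if "c \<in> {White, Black}" for c
    using assms that SS5_Box_in[of "{#Form F#}" c "dual A"] SS5_BBox_in[of "{#Form F#}" c "dual A"]
      SS5_Four[OF SS5_diamond_White(1) that, of White A] SS5_Four[OF SS5_diamond_White(2) that, of Black A]
    by auto
  show "derivable SS5 {#Form F, Form (dual (Dia F))#}"
    using SS5_Box[OF *[of White]] by (simp add: ac_simps add_mset_commute)
  show "derivable SS5 {#Form F, Form (dual (BDia F))#}"
    using SS5_BBox[OF *[of Black]] by (simp add: ac_simps add_mset_commute)
qed

text \<open>The diamond rule takes \<open>F\<close> out of the structure with one more diamond in
  front, a cut against transitivity removes that diamond, and contraction merges the copies.\<close>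

lemma SS5_propagate:
  assumes "F \<in> {Dia A, BDia A}" "c \<in> {White, Black}"
    and "derivable SS5 (\<Gamma> + {#Form F, c (\<Delta> + {#Form F#})#})"
  shows "derivable SS5 (\<Gamma> + {#Form F, c \<Delta>#})"
proof -
  have *: "derivable SS5 (\<Gamma> + {#Form F, c \<Delta>#})"
    if "derivable SS5 (\<Gamma> + {#Form F, c \<Delta>#} + {#Form G#})"
      "derivable SS5 {#Form F, Form (dual G)#}" for G
    using SS5_cut[of "\<Gamma> + {#Form F, c \<Delta>#}" G "{#Form F#}"] that
      SS5_ctr[of "\<Gamma> + {#c \<Delta>#}" "{#Form F#}"] by (simp add: ac_simps add_mset_commute)
  from assms(2) consider "c = White" | "c = Black" by auto
  then show ?thesis
  proof cases
    case 1
    have "derivable SS5 ((\<Gamma> + {#Form F#}) + {#White \<Delta>, Form (Dia F)#})"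
      by (rule SS5_unary[OF SS5.SKt[OF SKt.dia]])
        (use assms(3) 1 in \<open>simp add: ac_simps add_mset_commute\<close>)
    then show ?thesis
      using 1 by (intro *[OF _ SS5_transitivity(1)[OF assms(1)]]) (simp add: ac_simps add_mset_commute)
  next
    case 2
    have "derivable SS5 ((\<Gamma> + {#Form F#}) + {#Black \<Delta>, Form (BDia F)#})"
      by (rule SS5_unary[OF SS5.SKt[OF SKt.bdia]])
        (use assms(3) 2 in \<open>simp add: ac_simps add_mset_commute\<close>)
    then show ?thesis
      using 2 by (intro *[OF _ SS5_transitivity(2)[OF assms(1)]]) (simp add: ac_simps add_mset_commute)
  qed
qed

section \<open>Shallow rules at any depth\<close>

text \<open>Each step towards the hole packs everything above into a structure of the opposite
  colour. \<Xi> is chosen before \<Delta>, so premise and conclusion of a rule share it.\<close>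

lemma SS5_display:
  "\<exists>\<Xi>. \<forall>\<Delta>. derivable SS5 (\<Theta> + fill \<Sigma> \<Delta>) \<longleftrightarrow> derivable SS5 (\<Xi> + \<Delta>)"
proof (induction \<Sigma> arbitrary: \<Theta>)
  case (Hole \<Gamma>)
  show ?case by (rule exI[of _ "\<Theta> + \<Gamma>"]) (simp add: ac_simps add_mset_commute)
next
  case (CWhite \<Gamma> \<Sigma>)
  show ?case
    using CWhite.IH[of "{#Black (\<Theta> + \<Gamma>)#}"] SS5_display_White[of "\<Theta> + \<Gamma>"]
    by (simp add: ac_simps add_mset_commute)
next
  case (CBlack \<Gamma> \<Sigma>)
  show ?case
    using CBlack.IH[of "{#White (\<Theta> + \<Gamma>)#}"] SS5_display_White[of _ "\<Theta> + \<Gamma>"]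
    by (simp add: ac_simps add_mset_commute)
qed

text \<open>Display reduces a step at depth to one at the root; the surroundings there depend on
  \<Sigma>, hence the hypothesis for every \<Xi>.\<close>

lemma SS5_deep:
  assumes "\<And>\<Xi>. derivable SS5 (\<Xi> + P) \<Longrightarrow> derivable SS5 (\<Xi> + Q)"
    and "derivable SS5 (fill \<Sigma> P)"
  shows "derivable SS5 (fill \<Sigma> Q)"
  using assms SS5_display[of "{#}" \<Sigma>] by auto

lemma SS5_DKt:
  assumes "DKt ps \<Gamma>" "\<And>\<Delta>. \<Delta> \<in> set ps \<Longrightarrow> derivable SS5 \<Delta>"
  shows "derivable SS5 \<Gamma>"
  using assms
proof cases
  case (id \<Sigma> a)
  obtain \<Xi> where "\<And>\<Delta>. derivable SS5 (fill \<Sigma> \<Delta>) \<longleftrightarrow> derivable SS5 (\<Xi> + \<Delta>)"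
    using SS5_display[of "{#}" \<Sigma>] by auto
  then show ?thesis
    using SS5_nullary[OF SS5.SKt[OF SKt.id[of \<Xi> a]]] id by simp
next
  case (conj \<Sigma> A B)
  \<comment> \<open>\<open>SS5_deep\<close> treats a single premise; here two premises have to be
    displayed with the same \<Xi>.\<close>
  obtain \<Xi> where \<Xi>: "\<And>\<Delta>. derivable SS5 (fill \<Sigma> \<Delta>) \<longleftrightarrow> derivable SS5 (\<Xi> + \<Delta>)"
    using SS5_display[of "{#}" \<Sigma>] by auto
  have "derivable SS5 (\<Xi> + {#Form (And A B), Form A#})"
    "derivable SS5 (\<Xi> + {#Form (And A B), Form B#})"
    using assms(2) conj unfolding \<Xi>[symmetric] by simp_all
  then have "derivable SS5 (\<Xi> + {#Form (And A B)#} + {#Form (And A B)#})"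
    by (intro SS5_binary[OF SS5.SKt[OF SKt.conj]]) (simp_all add: add_mset_commute)
  then show ?thesis
    unfolding conj \<Xi> by (rule SS5_ctr)
next
  case (disj \<Sigma> A B)
  have "derivable SS5 (fill \<Sigma> {#Form (Or A B)#})"
  proof (rule SS5_deep)
    fix \<Xi> assume "derivable SS5 (\<Xi> + {#Form (Or A B), Form A, Form B#})"
    then have "derivable SS5 ((\<Xi> + {#Form (Or A B)#}) + {#Form A, Form B#})"
      by (simp add: ac_simps add_mset_commute)
    from SS5_unary[OF SS5.SKt[OF SKt.disj] this]
    show "derivable SS5 (\<Xi> + {#Form (Or A B)#})"
      by (rule SS5_ctr)
  qed (use disj assms(2) in auto)
  then show ?thesis using disj by simp
next
  case (bbox \<Sigma> A)
  have "derivable SS5 (fill \<Sigma> {#Form (BBox A)#})"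
  proof (rule SS5_deep)
    fix \<Xi> assume "derivable SS5 (\<Xi> + {#Form (BBox A), Black {#Form A#}#})"
    then have "derivable SS5 ((\<Xi> + {#Form (BBox A)#}) + {#Black {#Form A#}#})"
      by (simp add: ac_simps add_mset_commute)
    then show "derivable SS5 (\<Xi> + {#Form (BBox A)#})"
      by (intro SS5_ctr[of \<Xi>] SS5_BBox)
  qed (use bbox assms(2) in auto)
  then show ?thesis using bbox by simp
next
  case (box \<Sigma> A)
  have "derivable SS5 (fill \<Sigma> {#Form (Box A)#})"
  proof (rule SS5_deep)
    fix \<Xi> assume "derivable SS5 (\<Xi> + {#Form (Box A), White {#Form A#}#})"
    then have "derivable SS5 ((\<Xi> + {#Form (Box A)#}) + {#White {#Form A#}#})"
      by (simp add: ac_simps add_mset_commute)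
    then show "derivable SS5 (\<Xi> + {#Form (Box A)#})"
      by (intro SS5_ctr[of \<Xi>] SS5_Box)
  qed (use box assms(2) in auto)
  then show ?thesis using box by simp
next
  case (bdia1 \<Sigma> \<Delta> A)
  then have "derivable SS5 (fill \<Sigma> {#Black (\<Delta> + {#Form A#}), Form (BDia A)#})"
    using assms(2) by simp
  then show ?thesis
    unfolding bdia1 by (rule SS5_deep[rotated]) (rule SS5_add_BDia)
next
  case (bdia2 \<Sigma> \<Delta> A)
  have "derivable SS5 (fill \<Sigma> {#White (\<Delta> + {#Form (BDia A)#})#})"
  proof (rule SS5_deep)
    fix \<Xi> assume "derivable SS5 (\<Xi> + {#White (\<Delta> + {#Form (BDia A)#}), Form A#})"
    \<comment> \<open>With the child at the root, the old parent is a black structure and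
      \<open>bdia2\<close> has become a case of \<open>bdia1\<close>.\<close>
    then have "derivable SS5 (\<Delta> + {#Black (\<Xi> + {#Form A#}), Form (BDia A)#})"
      using SS5_display_White[of "\<Xi> + {#Form A#}"] by (simp add: ac_simps add_mset_commute)
    from SS5_add_BDia[OF this]
    show "derivable SS5 (\<Xi> + {#White (\<Delta> + {#Form (BDia A)#})#})"
      using SS5_display_White[of "\<Xi>"] by (simp add: ac_simps add_mset_commute)
  qed (use bdia2 assms(2) in auto)
  then show ?thesis using bdia2 by simp
next
  case (dia1 \<Sigma> \<Delta> A)
  then have "derivable SS5 (fill \<Sigma> {#White (\<Delta> + {#Form A#}), Form (Dia A)#})"
    using assms(2) by simp
  then show ?thesis
    unfolding dia1 by (rule SS5_deep[rotated]) (rule SS5_add_Dia)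
next
  case (dia2 \<Sigma> \<Delta> A)
  have "derivable SS5 (fill \<Sigma> {#Black (\<Delta> + {#Form (Dia A)#})#})"
  proof (rule SS5_deep)
    fix \<Xi> assume "derivable SS5 (\<Xi> + {#Black (\<Delta> + {#Form (Dia A)#}), Form A#})"
    then have "derivable SS5 (\<Delta> + {#White (\<Xi> + {#Form A#}), Form (Dia A)#})"
      using SS5_display_White[of "\<Delta> + {#Form (Dia A)#}" "\<Xi> + {#Form A#}"] by (simp add: ac_simps add_mset_commute)
    from SS5_add_Dia[OF this]
    show "derivable SS5 (\<Xi> + {#Black (\<Delta> + {#Form (Dia A)#})#})"
      using SS5_display_White[of "\<Delta> + {#Form (Dia A)#}" \<Xi>] by (simp add: ac_simps add_mset_commute)
  qed (use dia2 assms(2) in auto)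
  then show ?thesis using dia2 by simp
qed

lemma SS5_deep_free:
  assumes "F \<in> {Dia A, BDia A}" "derivable SS5 (fill \<Sigma> {#Form F, Form A#})"
  shows "derivable SS5 (fill \<Sigma> {#Form F#})"
proof (rule SS5_deep[OF _ assms(2)])
  fix \<Xi> assume "derivable SS5 (\<Xi> + {#Form F, Form A#})"
  then have "derivable SS5 (\<Xi> + {#Form F#} + {#Form A#})"
    by (simp add: ac_simps add_mset_commute)
  then show "derivable SS5 (\<Xi> + {#Form F#})"
    using SS5_diamond_free[of "\<Xi> + {#Form F#}" A] SS5_ctr[of \<Xi> "{#Form F#}"] assms(1) by blast
qed

text \<open>Diamond and colour vary independently, which covers \<open>Four_a\<close>,
  \<open>Four_c\<close>, \<open>Five_a\<close> and \<open>Five_c\<close> at once.\<close>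

lemma SS5_deep_down:
  assumes "F \<in> {Dia A, BDia A}" "c \<in> {White, Black}"
    and "derivable SS5 (fill \<Sigma> {#Form F, c (\<Delta> + {#Form F#})#})"
  shows "derivable SS5 (fill \<Sigma> {#Form F, c \<Delta>#})"
  by (rule SS5_deep[OF SS5_propagate[OF assms(1,2)] assms(3)])

text \<open>Exchanging child and parent turns the upward move of \<open>F\<close> into a downward
  one, so \<open>SS5_propagate\<close> applies.\<close>

lemma SS5_deep_up:
  assumes F: "F \<in> {Dia A, BDia A}" and "c \<in> {White, Black}"
    and "derivable SS5 (fill \<Sigma> {#c (\<Delta> + {#Form F#}), Form F#})"
  shows "derivable SS5 (fill \<Sigma> {#c (\<Delta> + {#Form F#})#})"
proof (rule SS5_deep[OF _ assms(3)])
  fix \<Xi> assume \<Xi>: "derivable SS5 (\<Xi> + {#c (\<Delta> + {#Form F#}), Form F#})"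
  from assms(2) consider "c = White" | "c = Black" by auto
  then show "derivable SS5 (\<Xi> + {#c (\<Delta> + {#Form F#})#})"
  proof cases
    case 1
    have "derivable SS5 (\<Delta> + {#Form F, Black (\<Xi> + {#Form F#})#})"
      using \<Xi> 1 SS5_display_White[of "\<Xi> + {#Form F#}"] by (simp add: ac_simps add_mset_commute)
    then have "derivable SS5 (\<Delta> + {#Form F, Black \<Xi>#})"
      by (rule SS5_propagate[OF F, rotated]) simp
    then show ?thesis
      using 1 SS5_display_White[of \<Xi>] by (simp add: ac_simps add_mset_commute)
  next
    case 2
    have "derivable SS5 (\<Delta> + {#Form F, White (\<Xi> + {#Form F#})#})"
      using \<Xi> 2 SS5_display_White[of "\<Delta> + {#Form F#}" "\<Xi> + {#Form F#}"] by (simp add: ac_simps add_mset_commute)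
    then have "derivable SS5 (\<Delta> + {#Form F, White \<Xi>#})"
      by (rule SS5_propagate[OF F, rotated]) simp
    then show ?thesis
      using 2 SS5_display_White[of "\<Delta> + {#Form F#}" \<Xi>] by (simp add: ac_simps add_mset_commute)
  qed
qed

lemma SS5_if_DS5:
  assumes "derivable DS5 \<Gamma>"
  shows "derivable SS5 \<Gamma>"
  using assms
proof induction
  case (1 ps \<Gamma>)
  then have prem: "\<And>\<Delta>. \<Delta> \<in> set ps \<Longrightarrow> derivable SS5 \<Delta>" by blast
  from 1(1) show ?case
  proof cases
    case DKt
    then show ?thesis using prem by (rule SS5_DKt)
  next
    case (Ta \<Sigma> A)
    then show ?thesis
      using prem SS5_deep_free[of "BDia A" A \<Sigma>] by simp
  next
    case (Tb \<Sigma> A)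
    then show ?thesis
      using prem SS5_deep_free[of "Dia A" A \<Sigma>] by simp
  next
    case (Four_a \<Sigma> A \<Delta>)
    then show ?thesis
      using prem SS5_deep_down[of "BDia A" A Black \<Sigma> \<Delta>] by simp
  next
    case (Four_b \<Sigma> \<Delta> A)
    then show ?thesis
      using prem SS5_deep_up[of "BDia A" A White \<Sigma> \<Delta>] by simp
  next
    case (Four_c \<Sigma> A \<Delta>)
    then show ?thesis
      using prem SS5_deep_down[of "Dia A" A White \<Sigma> \<Delta>] by simp
  next
    case (Four_d \<Sigma> \<Delta> A)
    then show ?thesis
      using prem SS5_deep_up[of "Dia A" A Black \<Sigma> \<Delta>] by simp
  next
    case (Five_a \<Sigma> A \<Delta>)
    then show ?thesis
      using prem SS5_deep_down[of "BDia A" A White \<Sigma> \<Delta>] by simp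
  next
    case (Five_b \<Sigma> \<Delta> A)
    then show ?thesis
      using prem SS5_deep_up[of "Dia A" A White \<Sigma> \<Delta>] by simp
  next
    case (Five_c \<Sigma> A \<Delta>)
    then show ?thesis
      using prem SS5_deep_down[of "Dia A" A Black \<Sigma> \<Delta>] by simp
  next
    case (Five_d \<Sigma> \<Delta> A)
    then show ?thesis
      using prem SS5_deep_up[of "BDia A" A Black \<Sigma> \<Delta>] by simp
  qed
qed

section \<open>Universal models\<close>

primrec fm_sat :: "'a set set \<Rightarrow> 'a fm \<Rightarrow> 'a set \<Rightarrow> bool" where
  "fm_sat W (Atom a) v = (a \<in> v)"
| "fm_sat W (NAtom a) v = (a \<notin> v)"
| "fm_sat W (Or A B) v = (fm_sat W A v \<or> fm_sat W B v)"
| "fm_sat W (And A B) v = (fm_sat W A v \<and> fm_sat W B v)"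
| "fm_sat W (Box A) v = (\<forall>u\<in>W. fm_sat W A u)"
| "fm_sat W (BBox A) v = (\<forall>u\<in>W. fm_sat W A u)"
| "fm_sat W (Dia A) v = (\<exists>u\<in>W. fm_sat W A u)"
| "fm_sat W (BDia A) v = (\<exists>u\<in>W. fm_sat W A u)"

text \<open>Recursion into a multiset goes through \<open>image_mset\<close>, hence clauses that are
  predicates and range over an image; \<open>struct_sat_seq_sat\<close> gives the readable
  form.\<close>

primrec struct_sat :: "'a set set \<Rightarrow> 'a struct \<Rightarrow> 'a set \<Rightarrow> bool" where
  "struct_sat W (Form A) = fm_sat W A"
| "struct_sat W (White \<Gamma>) = (\<lambda>v. \<forall>u\<in>W. \<exists>f\<in>#image_mset (struct_sat W) \<Gamma>. f u)"
| "struct_sat W (Black \<Gamma>) = (\<lambda>v. \<forall>u\<in>W. \<exists>f\<in>#image_mset (struct_sat W) \<Gamma>. f u)"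

definition seq_sat :: "'a set set \<Rightarrow> 'a sequent \<Rightarrow> 'a set \<Rightarrow> bool" where
  "seq_sat W \<Gamma> v \<longleftrightarrow> (\<exists>s\<in>#\<Gamma>. struct_sat W s v)"

definition valid :: "'a sequent \<Rightarrow> bool" where
  "valid \<Gamma> \<longleftrightarrow> (\<forall>W. \<forall>v\<in>W. seq_sat W \<Gamma> v)"

lemma seq_sat_simps [simp]:
  "\<not> seq_sat W {#} v"
  "seq_sat W (add_mset s \<Gamma>) v \<longleftrightarrow> struct_sat W s v \<or> seq_sat W \<Gamma> v"
  "seq_sat W (\<Gamma> + \<Delta>) v \<longleftrightarrow> seq_sat W \<Gamma> v \<or> seq_sat W \<Delta> v"
  by (auto simp: seq_sat_def)

lemma struct_sat_seq_sat:
  "struct_sat W (White \<Gamma>) v \<longleftrightarrow> (\<forall>u\<in>W. seq_sat W \<Gamma> u)"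
  "struct_sat W (Black \<Gamma>) v \<longleftrightarrow> (\<forall>u\<in>W. seq_sat W \<Gamma> u)"
  by (auto simp: seq_sat_def)

declare struct_sat.simps(2,3) [simp del] struct_sat_seq_sat [simp]

lemma fm_sat_dual [simp]: "fm_sat W (dual A) v \<longleftrightarrow> \<not> fm_sat W A v"
  by (induction A arbitrary: v) auto

text \<open>Truth is preserved over a whole model, not pointwise. That \<Gamma> beside a structure
  with content \<Delta> holds throughout \<open>W\<close> means that \<Gamma> holds throughout or
  \<Delta> does; this is symmetric, so \<open>rf\<close> and \<open>rp\<close> are sound.\<close>

lemma SKt_sound:
  assumes "SKt ps \<Gamma>" "\<forall>\<Delta>\<in>set ps. \<forall>v\<in>W. seq_sat W \<Delta> v"
  shows "\<forall>v\<in>W. seq_sat W \<Gamma> v"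
  using assms by cases (simp_all, blast+)

lemma SS5_sound: "derivable SS5 \<Gamma> \<Longrightarrow> valid \<Gamma>"
proof (induction rule: derivable.induct)
  case (1 ps \<Gamma>)
  show ?case
    unfolding valid_def
  proof
    fix W
    have prem: "\<forall>\<Delta>\<in>set ps. \<forall>v\<in>W. seq_sat W \<Delta> v"
      using 1 unfolding valid_def by blast
    from 1(1) show "\<forall>v\<in>W. seq_sat W \<Gamma> v"
    proof cases
      case SKt
      then show ?thesis using SKt_sound prem by blast
    qed (use prem in \<open>simp_all, blast+\<close>)
  qed
qed

lemma seq_sat_fill_mono:
  assumes "\<And>u. seq_sat W \<Delta> u \<Longrightarrow> seq_sat W \<Delta>' u" "seq_sat W (fill \<Sigma> \<Delta>) v"
  shows "seq_sat W (fill \<Sigma> \<Delta>') v"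
  using assms(2) by (induction \<Sigma> arbitrary: v) (use assms(1) in auto)

lemma valid_fill_plus: "valid (fill \<Sigma> \<Delta>) \<Longrightarrow> valid (fill \<Sigma> (\<Theta> + \<Delta>))"
  unfolding valid_def by (meson seq_sat_fill_mono seq_sat_simps(3))

section \<open>Nodes of a nested sequent\<close>

definition label :: "'a sequent \<Rightarrow> 'a fm set" where
  "label \<Gamma> = {A. Form A \<in># \<Gamma>}"

lemma label_simps [simp]:
  "label {#} = {}"
  "label (add_mset (Form A) \<Gamma>) = insert A (label \<Gamma>)"
  "label (add_mset (White \<Delta>) \<Gamma>) = label \<Gamma>"
  "label (add_mset (Black \<Delta>) \<Gamma>) = label \<Gamma>"
  by (auto simp: label_def)

text \<open>The nodes are the structures; a sequent is wrapped in \<open>White\<close> later so that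
  its root counts too. Nodes with equal labels are identified, as they can share a world.\<close>

primrec labels :: "'a struct \<Rightarrow> 'a fm set set" where
  "labels (Form A) = {}"
| "labels (White \<Gamma>) = insert (label \<Gamma>) (\<Union> (set_mset (image_mset labels \<Gamma>)))"
| "labels (Black \<Gamma>) = insert (label \<Gamma>) (\<Union> (set_mset (image_mset labels \<Gamma>)))"

text \<open>Unlike \<open>labels\<close>, the sum counts every node separately, so adding a missing
  formula of a finite \<open>C\<close> to any node lowers it.\<close>

primrec deficit :: "'a fm set \<Rightarrow> 'a struct \<Rightarrow> nat" where
  "deficit C (Form A) = 0"
| "deficit C (White \<Gamma>) = card (C - label \<Gamma>) + sum_mset (image_mset (deficit C) \<Gamma>)"
| "deficit C (Black \<Gamma>) = card (C - label \<Gamma>) + sum_mset (image_mset (deficit C) \<Gamma>)"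

text \<open>In a tight context there is nothing beside the hole, so that the hole is an entire node.\<close>

primrec tight :: "'a ctx \<Rightarrow> bool" where
  "tight (Hole \<Gamma>) \<longleftrightarrow> \<Gamma> = {#}"
| "tight (CWhite \<Gamma> \<Sigma>) \<longleftrightarrow> tight \<Sigma>"
| "tight (CBlack \<Gamma> \<Sigma>) \<longleftrightarrow> tight \<Sigma>"

text \<open>Material beside the hole would merge with the label of \<Delta>; tightness excludes
  this. \<open>White\<close> also stands in for black nodes, since both colours have the same
  labels.\<close>

lemma labels_fill:
  "tight \<Sigma> \<Longrightarrow> \<exists>L. \<forall>\<Delta>. labels (White (fill \<Sigma> \<Delta>)) = L \<union> labels (White \<Delta>)"
proof (induction \<Sigma>)
  case (Hole \<Gamma>)
  then show ?case by (intro exI[of _ "{}"]) simp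
next
  case (CWhite \<Gamma> \<Sigma>)
  then obtain L where "\<And>\<Delta>. labels (White (fill \<Sigma> \<Delta>)) = L \<union> labels (White \<Delta>)" by auto
  then show ?case
    by (intro exI[of _ "labels (White \<Gamma>) \<union> L"]) auto
next
  case (CBlack \<Gamma> \<Sigma>)
  then obtain L where "\<And>\<Delta>. labels (White (fill \<Sigma> \<Delta>)) = L \<union> labels (White \<Delta>)" by auto
  then show ?case
    by (intro exI[of _ "labels (White \<Gamma>) \<union> L"]) auto
qed

lemma deficit_fill:
  "tight \<Sigma> \<Longrightarrow> \<exists>k. \<forall>\<Delta>. deficit C (White (fill \<Sigma> \<Delta>)) = k + deficit C (White \<Delta>)"
proof (induction \<Sigma>)
  case (Hole \<Gamma>)
  then show ?case by (intro exI[of _ 0]) simp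
next
  case (CWhite \<Gamma> \<Sigma>)
  then obtain k where "\<And>\<Delta>. deficit C (White (fill \<Sigma> \<Delta>)) = k + deficit C (White \<Delta>)" by auto
  then show ?case
    by (intro exI[of _ "deficit C (White \<Gamma>) + k"]) simp
next
  case (CBlack \<Gamma> \<Sigma>)
  then obtain k where "\<And>\<Delta>. deficit C (White (fill \<Sigma> \<Delta>)) = k + deficit C (White \<Delta>)" by auto
  then show ?case
    by (intro exI[of _ "deficit C (White \<Gamma>) + k"]) simp
qed

lemma label_in_labels_fill: "tight \<Sigma> \<Longrightarrow> label \<Delta> \<in> labels (White (fill \<Sigma> \<Delta>))"
  using labels_fill[of \<Sigma>] by auto

lemma labels_struct_fill:
  "w \<in> labels s \<Longrightarrow>
    \<exists>\<Sigma> \<Delta>. tight \<Sigma> \<and> w = label \<Delta> \<and> (s = White (fill \<Sigma> \<Delta>) \<or> s = Black (fill \<Sigma> \<Delta>))"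
proof (induction s)
  case (Form A)
  then show ?case by simp
next
  \<comment> \<open>Both colours need the same argument, so it is proved once with the induction
    hypothesis as an assumption.\<close>
  have step: "\<exists>\<Sigma> \<Delta>. tight \<Sigma> \<and> w = label \<Delta> \<and> \<Gamma> = fill \<Sigma> \<Delta>"
    if "w = label \<Gamma> \<or> (\<exists>s\<in>#\<Gamma>. w \<in> labels s)"
      and IH: "\<And>s. s \<in># \<Gamma> \<Longrightarrow> w \<in> labels s \<Longrightarrow> \<exists>\<Sigma> \<Delta>. tight \<Sigma> \<and> w = label \<Delta> \<and>
        (s = White (fill \<Sigma> \<Delta>) \<or> s = Black (fill \<Sigma> \<Delta>))" for \<Gamma>
    using that(1)
  proof
    assume "w = label \<Gamma>"
    then show ?thesis
      by (intro exI[of _ "Hole {#}"] exI[of _ \<Gamma>]) simp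
  next
    assume "\<exists>s\<in>#\<Gamma>. w \<in> labels s"
    then obtain s \<Sigma> \<Delta> where s: "s \<in># \<Gamma>" and \<Sigma>: "tight \<Sigma>" "w = label \<Delta>"
      "s = White (fill \<Sigma> \<Delta>) \<or> s = Black (fill \<Sigma> \<Delta>)"
      using IH by blast
    obtain \<Gamma>' where "\<Gamma> = \<Gamma>' + {#s#}"
      using multi_member_split[OF s] by auto
    then have "\<Gamma> = fill (CWhite \<Gamma>' \<Sigma>) \<Delta> \<or> \<Gamma> = fill (CBlack \<Gamma>' \<Sigma>) \<Delta>"
      using \<Sigma>(3) by auto
    moreover have "tight (CWhite \<Gamma>' \<Sigma>)" "tight (CBlack \<Gamma>' \<Sigma>)"
      using \<Sigma>(1) by auto
    ultimately show ?thesis using \<Sigma>(2) by blast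
  qed
  {
    case (White \<Gamma>)
    then show ?case using step[of \<Gamma>] by auto
  next
    case (Black \<Gamma>)
    then show ?case using step[of \<Gamma>] by auto
  }
qed

lemma labels_fillE:
  assumes "w \<in> labels (White \<Gamma>)"
  obtains \<Sigma> \<Delta> where "tight \<Sigma>" "\<Gamma> = fill \<Sigma> \<Delta>" "w = label \<Delta>"
  using labels_struct_fill[OF assms] by auto

text \<open>The deep rules have only principal material in the hole; this moves the rest of the node
  into the context.\<close>

lemma fill_absorb: "\<exists>\<Sigma>'. \<forall>\<Delta>. fill \<Sigma>' \<Delta> = fill \<Sigma> (\<Theta> + \<Delta>)"
proof (induction \<Sigma>)
  case (Hole \<Gamma>)
  show ?case by (rule exI[of _ "Hole (\<Gamma> + \<Theta>)"]) (simp add: ac_simps add_mset_commute)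
next
  case (CWhite \<Gamma> \<Sigma>)
  then show ?case by (metis fill.simps(2))
next
  case (CBlack \<Gamma> \<Sigma>)
  then show ?case by (metis fill.simps(3))
qed

text \<open>Moves the focus from a node to one of its children, where the hole is again an entire
  node.\<close>

lemma fill_child:
  assumes "tight \<Sigma>" "c \<in> {White, Black}"
  shows "\<exists>\<Sigma>'. tight \<Sigma>' \<and> (\<forall>\<Delta>. fill \<Sigma>' \<Delta> = fill \<Sigma> (add_mset (c \<Delta>) \<Theta>))"
  using assms(1)
proof (induction \<Sigma>)
  case (Hole \<Gamma>)
  show ?case
  proof (cases "c = White")
    case True
    with Hole show ?thesis
      by (intro exI[of _ "CWhite \<Theta> (Hole {#})"]) auto
  next
    case False
    with Hole assms(2) show ?thesis
      by (intro exI[of _ "CBlack \<Theta> (Hole {#})"]) auto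
  qed
next
  case (CWhite \<Gamma> \<Sigma>)
  then show ?case by (metis fill.simps(2) tight.simps(2))
next
  case (CBlack \<Gamma> \<Sigma>)
  then show ?case by (metis fill.simps(3) tight.simps(3))
qed

section \<open>Subformulas and finiteness of labels\<close>

primrec subformulas :: "'a fm \<Rightarrow> 'a fm set" where
  "subformulas (Atom a) = {Atom a}"
| "subformulas (NAtom a) = {NAtom a}"
| "subformulas (Or A B) = insert (Or A B) (subformulas A \<union> subformulas B)"
| "subformulas (And A B) = insert (And A B) (subformulas A \<union> subformulas B)"
| "subformulas (Box A) = insert (Box A) (subformulas A)"
| "subformulas (BBox A) = insert (BBox A) (subformulas A)"
| "subformulas (Dia A) = insert (Dia A) (subformulas A)"
| "subformulas (BDia A) = insert (BDia A) (subformulas A)"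

lemma finite_subformulas: "finite (subformulas A)"
  by (induction A) auto

lemma subformulas_refl: "A \<in> subformulas A"
  by (cases A) auto

lemma subformulas_trans: "A \<in> subformulas B \<Longrightarrow> subformulas A \<subseteq> subformulas B"
  by (induction B) auto

lemma finite_label: "finite (label \<Gamma>)"
proof -
  have "label \<Gamma> = Form -` set_mset \<Gamma>"
    by (auto simp: label_def)
  then show ?thesis
    by (simp add: finite_vimageI inj_def)
qed

lemma finite_labels: "finite (\<Union> (labels s))"
proof (rule finite_Union)
  show "finite (labels s)" by (induction s) auto
  show "finite w" if "w \<in> labels s" for w
    using that by (induction s) (use finite_label in auto)
qed

section \<open>Completeness of the deep calculus\<close>

lemmas DS5_nullary = derivable_nullary[where R = DS5]
lemmas DS5_unary = derivable_unary[where R = DS5]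
lemmas DS5_binary = derivable_binary[where R = DS5]

lemma DS5_absorb:
  assumes "derivable DS5 (fill \<Sigma> (\<Theta> + P))"
    and "\<And>\<Sigma>. derivable DS5 (fill \<Sigma> P) \<Longrightarrow> derivable DS5 (fill \<Sigma> Q)"
  shows "derivable DS5 (fill \<Sigma> (\<Theta> + Q))"
  using assms fill_absorb[of \<Sigma> \<Theta>] by metis

lemma DS5_id:
  assumes "Form (Atom a) \<in># \<Delta>" "Form (NAtom a) \<in># \<Delta>"
  shows "derivable DS5 (fill \<Sigma> \<Delta>)"
proof -
  obtain \<Theta> where "\<Delta> = \<Theta> + {#Form (Atom a), Form (NAtom a)#}"
    using assms by (metis multi_member_split add_mset_add_single fm.distinct(1) insert_noteq_member struct.inject(1) union_mset_add_mset_right)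
  moreover obtain \<Sigma>' where "\<And>X. fill \<Sigma>' X = fill \<Sigma> (\<Theta> + X)"
    using fill_absorb by metis
  ultimately show ?thesis
    using DS5_nullary[OF DS5.DKt[OF DKt.id[of \<Sigma>' a]]] by simp
qed

lemma DS5_conj:
  assumes "Form (And A B) \<in># \<Delta>"
    and "derivable DS5 (fill \<Sigma> (add_mset (Form A) \<Delta>))"
    and "derivable DS5 (fill \<Sigma> (add_mset (Form B) \<Delta>))"
  shows "derivable DS5 (fill \<Sigma> \<Delta>)"
proof -
  obtain \<Theta> where \<Theta>: "\<Delta> = \<Theta> + {#Form (And A B)#}"
    using assms(1) by (auto dest!: multi_member_split)
  obtain \<Sigma>' where \<Sigma>': "\<And>X. fill \<Sigma>' X = fill \<Sigma> (\<Theta> + X)"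
    using fill_absorb by metis
  show ?thesis
    using DS5_binary[OF DS5.DKt[OF DKt.conj[of \<Sigma>' A B]]] assms(2,3)
    by (simp add: \<Theta> \<Sigma>' add_mset_commute)
qed

lemma DS5_disj:
  assumes "Form (Or A B) \<in># \<Delta>"
    and "derivable DS5 (fill \<Sigma> (add_mset (Form A) (add_mset (Form B) \<Delta>)))"
  shows "derivable DS5 (fill \<Sigma> \<Delta>)"
proof -
  obtain \<Theta> where \<Theta>: "\<Delta> = \<Theta> + {#Form (Or A B)#}"
    using assms(1) by (auto dest!: multi_member_split)
  have "derivable DS5 (fill \<Sigma> (\<Theta> + {#Form (Or A B), Form A, Form B#}))"
    using assms(2) by (simp add: \<Theta> add_mset_commute)
  then show ?thesis
    unfolding \<Theta> by (rule DS5_absorb[OF _ DS5_unary[OF DS5.DKt[OF DKt.disj]]])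
qed

lemma DS5_Box:
  assumes "Form (Box A) \<in># \<Delta>"
    and "derivable DS5 (fill \<Sigma> (add_mset (White {#Form A#}) \<Delta>))"
  shows "derivable DS5 (fill \<Sigma> \<Delta>)"
proof -
  obtain \<Theta> where \<Theta>: "\<Delta> = \<Theta> + {#Form (Box A)#}"
    using assms(1) by (auto dest!: multi_member_split)
  have "derivable DS5 (fill \<Sigma> (\<Theta> + {#Form (Box A), White {#Form A#}#}))"
    using assms(2) by (simp add: \<Theta> add_mset_commute)
  then show ?thesis
    unfolding \<Theta> by (rule DS5_absorb[OF _ DS5_unary[OF DS5.DKt[OF DKt.box]]])
qed

lemma DS5_BBox:
  assumes "Form (BBox A) \<in># \<Delta>"
    and "derivable DS5 (fill \<Sigma> (add_mset (Black {#Form A#}) \<Delta>))"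
  shows "derivable DS5 (fill \<Sigma> \<Delta>)"
proof -
  obtain \<Theta> where \<Theta>: "\<Delta> = \<Theta> + {#Form (BBox A)#}"
    using assms(1) by (auto dest!: multi_member_split)
  have "derivable DS5 (fill \<Sigma> (\<Theta> + {#Form (BBox A), Black {#Form A#}#}))"
    using assms(2) by (simp add: \<Theta> add_mset_commute)
  then show ?thesis
    unfolding \<Theta> by (rule DS5_absorb[OF _ DS5_unary[OF DS5.DKt[OF DKt.bbox]]])
qed

lemma DS5_diamond:
  assumes "F \<in> {Dia A, BDia A}" "Form F \<in># \<Delta>"
    and "derivable DS5 (fill \<Sigma> (add_mset (Form A) \<Delta>))"
  shows "derivable DS5 (fill \<Sigma> \<Delta>)"
proof -
  obtain \<Theta> where \<Theta>: "\<Delta> = \<Theta> + {#Form F#}"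
    using assms(2) by (auto dest!: multi_member_split)
  have "derivable DS5 (fill \<Sigma> (\<Theta> + {#Form F, Form A#}))"
    using assms(3) by (simp add: \<Theta> add_mset_commute)
  then show ?thesis
    unfolding \<Theta>
    by (rule DS5_absorb)
      (use assms(1) in \<open>auto intro: DS5_unary[OF DS5.Ta] DS5_unary[OF DS5.Tb]\<close>)
qed

text \<open>Together with \<open>DS5_up\<close> this carries a diamond of either colour across an
  edge of either colour, in both directions.\<close>

lemma DS5_down:
  assumes "F \<in> {Dia A, BDia A}" "c \<in> {White, Black}" "Form F \<in># \<Delta>"
    and "derivable DS5 (fill \<Sigma> (add_mset (c (add_mset (Form F) \<Theta>)) \<Delta>))"
  shows "derivable DS5 (fill \<Sigma> (add_mset (c \<Theta>) \<Delta>))"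
proof -
  obtain \<Xi> where \<Xi>: "\<Delta> = \<Xi> + {#Form F#}"
    using assms(3) by (auto dest!: multi_member_split)
  have "derivable DS5 (fill \<Sigma> (\<Xi> + {#Form F, c ({#Form F#} + \<Theta>)#}))"
    using assms(4) by (simp add: \<Xi> add_mset_commute)
  then have "derivable DS5 (fill \<Sigma> (\<Xi> + {#Form F, c \<Theta>#}))"
  proof (rule DS5_absorb)
    fix \<Sigma> assume "derivable DS5 (fill \<Sigma> {#Form F, c ({#Form F#} + \<Theta>)#})"
    then show "derivable DS5 (fill \<Sigma> {#Form F, c \<Theta>#})"
      using assms(1,2) DS5.Four_a[THEN DS5_unary] DS5.Four_c[THEN DS5_unary]
        DS5.Five_a[THEN DS5_unary] DS5.Five_c[THEN DS5_unary] by blast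
  qed
  then show ?thesis
    by (simp add: \<Xi> add_mset_commute)
qed

lemma DS5_up:
  assumes "F \<in> {Dia A, BDia A}" "c \<in> {White, Black}" "Form F \<in># \<Theta>"
    and "derivable DS5 (fill \<Sigma> (add_mset (Form F) (add_mset (c \<Theta>) \<Delta>)))"
  shows "derivable DS5 (fill \<Sigma> (add_mset (c \<Theta>) \<Delta>))"
proof -
  obtain \<Xi> where \<Xi>: "\<Theta> = \<Xi> + {#Form F#}"
    using assms(3) by (auto dest!: multi_member_split)
  have "derivable DS5 (fill \<Sigma> (\<Delta> + {#c (\<Xi> + {#Form F#}), Form F#}))"
    using assms(4) by (simp add: \<Xi> add_mset_commute)
  then have "derivable DS5 (fill \<Sigma> (\<Delta> + {#c (\<Xi> + {#Form F#})#}))"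
  proof (rule DS5_absorb)
    fix \<Sigma> assume "derivable DS5 (fill \<Sigma> {#c (\<Xi> + {#Form F#}), Form F#})"
    then show "derivable DS5 (fill \<Sigma> {#c (\<Xi> + {#Form F#})#})"
      using assms(1,2) DS5.Four_b[THEN DS5_unary] DS5.Four_d[THEN DS5_unary]
        DS5.Five_b[THEN DS5_unary] DS5.Five_d[THEN DS5_unary] by blast
  qed
  then show ?thesis
    by (simp add: \<Xi>)
qed

section \<open>Saturated trees and their countermodels\<close>

text \<open>The two ends of every edge agree on \<open>F\<close>; the induction follows the path
  from the root to the hole. An edge of the subtree becomes one of the whole tree by extending its
  context.\<close>

lemma propagated_everywhere:
  assumes "tight \<Sigma>"
    and "\<And>\<Sigma>' \<Delta>' \<Theta> c. tight \<Sigma>' \<Longrightarrow> fill \<Sigma> \<Delta> = fill \<Sigma>' (add_mset (c \<Theta>) \<Delta>') \<Longrightarrow>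
      c \<in> {White, Black} \<Longrightarrow> F \<in> label \<Delta>' \<longleftrightarrow> F \<in> label \<Theta>"
  shows "F \<in> label (fill \<Sigma> \<Delta>) \<longleftrightarrow> F \<in> label \<Delta>"
  using assms
proof (induction \<Sigma>)
  case (Hole \<Gamma>)
  then show ?case by simp
next
  case (CWhite \<Gamma> \<Sigma>)
  have "F \<in> label \<Gamma> \<longleftrightarrow> F \<in> label (fill \<Sigma> \<Delta>)"
    using CWhite.prems(2)[of "Hole {#}" White "fill \<Sigma> \<Delta>" \<Gamma>] by simp
  moreover have "F \<in> label (fill \<Sigma> \<Delta>) \<longleftrightarrow> F \<in> label \<Delta>"
  proof (rule CWhite.IH)
    fix \<Sigma>' \<Delta>' \<Theta> c
    assume "tight \<Sigma>'" "fill \<Sigma> \<Delta> = fill \<Sigma>' (add_mset (c \<Theta>) \<Delta>')" "c \<in> {White, Black}"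
    then show "F \<in> label \<Delta>' \<longleftrightarrow> F \<in> label \<Theta>"
      using CWhite.prems(2)[of "CWhite \<Gamma> \<Sigma>'" c \<Theta> \<Delta>'] by simp
  qed (use CWhite.prems in simp)
  ultimately show ?case by simp
next
  case (CBlack \<Gamma> \<Sigma>)
  have "F \<in> label \<Gamma> \<longleftrightarrow> F \<in> label (fill \<Sigma> \<Delta>)"
    using CBlack.prems(2)[of "Hole {#}" Black "fill \<Sigma> \<Delta>" \<Gamma>] by simp
  moreover have "F \<in> label (fill \<Sigma> \<Delta>) \<longleftrightarrow> F \<in> label \<Delta>"
  proof (rule CBlack.IH)
    fix \<Sigma>' \<Delta>' \<Theta> c
    assume "tight \<Sigma>'" "fill \<Sigma> \<Delta> = fill \<Sigma>' (add_mset (c \<Theta>) \<Delta>')" "c \<in> {White, Black}"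
    then show "F \<in> label \<Delta>' \<longleftrightarrow> F \<in> label \<Theta>"
      using CBlack.prems(2)[of "CBlack \<Gamma> \<Sigma>'" c \<Theta> \<Delta>'] by simp
  qed (use CBlack.prems in simp)
  ultimately show ?case by simp
qed

text \<open>The countermodel has to falsify all formulas of a label, atoms included, hence the
  negation.\<close>

definition valuation :: "'a fm set \<Rightarrow> 'a set" where
  "valuation w = {a. Atom a \<notin> w}"

text \<open>A structure is refuted by its own node: by induction all its members fail at the world
  given by its label.\<close>

lemma struct_sat_countermodel:
  assumes "\<And>w A. w \<in> L \<Longrightarrow> A \<in> w \<Longrightarrow> \<not> fm_sat (valuation ` L) A (valuation w)"
    and "labels s \<subseteq> L" "w \<in> L" "\<And>A. s = Form A \<Longrightarrow> A \<in> w"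
  shows "\<not> struct_sat (valuation ` L) s (valuation w)"
  using assms(2-)
proof (induction s arbitrary: w)
  case (Form A)
  then show ?case using assms(1) by simp
next
  case (White \<Gamma>)
  have "\<not> struct_sat (valuation ` L) s (valuation (label \<Gamma>))" if "s \<in># \<Gamma>" for s
    by (rule White.IH[OF that]) (use that White.prems in \<open>auto simp: label_def\<close>)
  moreover have "label \<Gamma> \<in> L" using White.prems by simp
  ultimately show ?case by (auto simp: seq_sat_def)
next
  case (Black \<Gamma>)
  have "\<not> struct_sat (valuation ` L) s (valuation (label \<Gamma>))" if "s \<in># \<Gamma>" for s
    by (rule Black.IH[OF that]) (use that Black.prems in \<open>auto simp: label_def\<close>)
  moreover have "label \<Gamma> \<in> L" using Black.prems by simp
  ultimately show ?case by (auto simp: seq_sat_def)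
qed

text \<open>The measure is lexicographic. A new node may raise the deficit, but its formula occurred
  nowhere before, so the first component drops; adding formulas to a node lowers the deficit and
  does not raise the first component.\<close>

lemma DS5_complete_over:
  assumes fin: "finite C" and sub: "\<And>A. A \<in> C \<Longrightarrow> subformulas A \<subseteq> C"
  shows "valid \<Gamma> \<Longrightarrow> \<Union> (labels (White \<Gamma>)) \<subseteq> C \<Longrightarrow> derivable DS5 \<Gamma>"
proof (induction \<Gamma> rule: wf_induct_rule[OF wf_measures[of
      "[\<lambda>\<Gamma>. card (C - \<Union> (labels (White \<Gamma>))), \<lambda>\<Gamma>. deficit C (White \<Gamma>)]"]])
  case (1 \<Gamma>)
  note IH = 1(1) and val = 1(2) and over = 1(3)
  have inC: "A \<in> C" if "tight \<Sigma>" "\<Gamma> = fill \<Sigma> \<Delta>" "Form A \<in># \<Delta>" for \<Sigma> \<Delta> A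
  proof -
    have "label \<Delta> \<in> labels (White \<Gamma>)" using that label_in_labels_fill by blast
    then show ?thesis using over that(3) by (auto simp: label_def)
  qed
  \<comment> \<open>\<open>N\<close> allows for several formulas because a disjunction adds both
    disjuncts in one step; one of them missing at the node suffices.\<close>
  have grow: "derivable DS5 (fill \<Sigma> (image_mset Form N + \<Delta>))"
    if t: "tight \<Sigma>" and \<Gamma>: "\<Gamma> = fill \<Sigma> \<Delta>" and N: "set_mset N \<subseteq> C" "\<not> set_mset N \<subseteq> label \<Delta>"
    for \<Sigma> \<Delta> N
  proof (rule IH)
    let ?\<Gamma>' = "fill \<Sigma> (image_mset Form N + \<Delta>)"
    obtain L where L: "\<And>\<Delta>. labels (White (fill \<Sigma> \<Delta>)) = L \<union> labels (White \<Delta>)"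
      using labels_fill[OF t] by blast
    obtain k where k: "\<And>\<Delta>. deficit C (White (fill \<Sigma> \<Delta>)) = k + deficit C (White \<Delta>)"
      using deficit_fill[OF t] by blast
    have label: "label (image_mset Form N + \<Delta>) = set_mset N \<union> label \<Delta>"
      by (auto simp: label_def)
    have lab: "\<Union> (labels (White ?\<Gamma>')) = set_mset N \<union> \<Union> (labels (White \<Gamma>))"
      unfolding \<Gamma> L by (auto simp: label)
    have "card (C - (set_mset N \<union> \<Union> (labels (White \<Gamma>)))) \<le> card (C - \<Union> (labels (White \<Gamma>)))"
      by (rule card_mono) (use fin in auto)
    moreover have "card (C - (set_mset N \<union> label \<Delta>)) < card (C - label \<Delta>)"
      by (rule psubset_card_mono) (use fin N in auto)
    then have "deficit C (White ?\<Gamma>') < deficit C (White \<Gamma>)"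
      unfolding \<Gamma> k by (simp add: label multiset.map_comp comp_def)
    ultimately show "(?\<Gamma>', \<Gamma>) \<in> measures
      [\<lambda>\<Gamma>. card (C - \<Union> (labels (White \<Gamma>))), \<lambda>\<Gamma>. deficit C (White \<Gamma>)]"
      by (simp only: measures_lesseq measures_less lab)
    show "valid ?\<Gamma>'"
      using val \<Gamma> valid_fill_plus by blast
    show "\<Union> (labels (White ?\<Gamma>')) \<subseteq> C"
      using lab over N by simp
  qed
  \<comment> \<open>\<open>A\<close> must be absent from all nodes, not only from this one, or the
    first component would stay the same.\<close>
  have new: "derivable DS5 (fill \<Sigma> (add_mset (c {#Form A#}) \<Delta>))"
    if t: "tight \<Sigma>" and \<Gamma>: "\<Gamma> = fill \<Sigma> \<Delta>" and c: "c \<in> {White, Black}"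
      and A: "A \<in> C" "A \<notin> \<Union> (labels (White \<Gamma>))" for \<Sigma> \<Delta> A c
  proof (rule IH)
    obtain L where L: "\<And>\<Delta>. labels (White (fill \<Sigma> \<Delta>)) = L \<union> labels (White \<Delta>)"
      using labels_fill[OF t] by blast
    have lab: "\<Union> (labels (White (fill \<Sigma> (add_mset (c {#Form A#}) \<Delta>)))) =
      insert A (\<Union> (labels (White \<Gamma>)))"
      unfolding \<Gamma> L using c by auto
    have "card (C - insert A (\<Union> (labels (White \<Gamma>)))) < card (C - \<Union> (labels (White \<Gamma>)))"
      by (rule psubset_card_mono) (use fin A in auto)
    then show "(fill \<Sigma> (add_mset (c {#Form A#}) \<Delta>), \<Gamma>) \<in> measures
      [\<lambda>\<Gamma>. card (C - \<Union> (labels (White \<Gamma>))), \<lambda>\<Gamma>. deficit C (White \<Gamma>)]"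
      by (intro measures_less) (simp only: lab)
    show "valid (fill \<Sigma> (add_mset (c {#Form A#}) \<Delta>))"
      using val \<Gamma> valid_fill_plus[of \<Sigma> \<Delta> "{#c {#Form A#}#}"] by simp
    show "\<Union> (labels (White (fill \<Sigma> (add_mset (c {#Form A#}) \<Delta>)))) \<subseteq> C"
      using lab over A by simp
  qed
  show ?case
  proof (rule ccontr)
    \<comment> \<open>By \<open>grow\<close> and \<open>new\<close>, premises that enlarge the
      sequent are derivable, so an underivable \<Gamma> is already saturated.\<close>
    assume under: "\<not> derivable DS5 \<Gamma>"
    define L where "L = labels (White \<Gamma>)"
    have add: "derivable DS5 (fill \<Sigma> (add_mset (Form A) \<Delta>))"
      if "tight \<Sigma>" "\<Gamma> = fill \<Sigma> \<Delta>" "A \<in> C" "A \<notin> label \<Delta>" for \<Sigma> \<Delta> A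
      using grow[OF that(1,2), of "{#A#}"] that(3,4) by simp
    have node: "\<exists>\<Sigma> \<Delta>. tight \<Sigma> \<and> \<Gamma> = fill \<Sigma> \<Delta> \<and> w = label \<Delta> \<and> Form A \<in># \<Delta> \<and> subformulas A \<subseteq> C"
      if w: "w \<in> L" "A \<in> w" for w A
    proof -
      obtain \<Sigma> \<Delta> where "tight \<Sigma>" "\<Gamma> = fill \<Sigma> \<Delta>" "w = label \<Delta>"
        using w(1) labels_fillE unfolding L_def by blast
      moreover have "A \<in> C" using over w by (auto simp: L_def)
      ultimately show ?thesis using w(2) sub by (auto simp: label_def)
    qed
    have atom: "NAtom a \<notin> w" if w: "w \<in> L" "Atom a \<in> w" for w a
    proof -
      obtain \<Sigma> \<Delta> where "\<Gamma> = fill \<Sigma> \<Delta>" "w = label \<Delta>" "Form (Atom a) \<in># \<Delta>"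
        using node[OF w] by blast
      then show ?thesis
        using under DS5_id[of a \<Delta> \<Sigma>] by (auto simp: label_def)
    qed
    have conj: "A \<in> w \<or> B \<in> w" if asm: "w \<in> L" "And A B \<in> w" for w A B
    proof -
      obtain \<Sigma> \<Delta> where *: "tight \<Sigma>" "\<Gamma> = fill \<Sigma> \<Delta>" and w: "w = label \<Delta>"
        and m: "Form (And A B) \<in># \<Delta>" and "subformulas (And A B) \<subseteq> C"
        using node[OF asm] by blast
      then have "A \<in> C" "B \<in> C" using subformulas_refl by auto
      then show ?thesis
        using DS5_conj[OF m, of \<Sigma>] add[OF *, of A] add[OF *, of B] under unfolding *(2) w by blast
    qed
    have disj: "A \<in> w \<and> B \<in> w" if asm: "w \<in> L" "Or A B \<in> w" for w A B
    proof -
      obtain \<Sigma> \<Delta> where *: "tight \<Sigma>" "\<Gamma> = fill \<Sigma> \<Delta>" and w: "w = label \<Delta>"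
        and m: "Form (Or A B) \<in># \<Delta>" and "subformulas (Or A B) \<subseteq> C"
        using node[OF asm] by blast
      then have "set_mset {#A, B#} \<subseteq> C" using subformulas_refl by auto
      then show ?thesis
        using DS5_disj[OF m, of \<Sigma>] grow[OF *, of "{#A, B#}"] under unfolding *(2) w by auto
    qed
    \<comment> \<open>If no node had \<open>A\<close>, then \<open>new\<close> would make \<Gamma>
      derivable. Any node will do as \<open>u\<close>, since all worlds see each other.\<close>
    have box: "\<exists>u\<in>L. A \<in> u" if asm: "w \<in> L" "F \<in> w" "F \<in> {Box A, BBox A}" for w A F
    proof -
      obtain \<Sigma> \<Delta> where *: "tight \<Sigma>" "\<Gamma> = fill \<Sigma> \<Delta>"
        and m: "Form F \<in># \<Delta>" and "subformulas F \<subseteq> C"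
        using node[OF asm(1,2)] by blast
      then have "A \<in> C" using subformulas_refl[of A] asm(3) by auto
      then show ?thesis
        using DS5_Box[of A \<Delta> \<Sigma>] DS5_BBox[of A \<Delta> \<Sigma>] new[OF *, of White A] new[OF *, of Black A]
          asm(3) m under unfolding L_def *(2) by blast
    qed
    have free: "A \<in> w" if asm: "w \<in> L" "F \<in> w" "F \<in> {Dia A, BDia A}" for w A F
    proof -
      obtain \<Sigma> \<Delta> where *: "tight \<Sigma>" "\<Gamma> = fill \<Sigma> \<Delta>" and w: "w = label \<Delta>"
        and m: "Form F \<in># \<Delta>" and "subformulas F \<subseteq> C"
        using node[OF asm(1,2)] by blast
      then have "A \<in> C" using subformulas_refl[of A] asm(3) by auto
      then show ?thesis
        using DS5_diamond[OF asm(3) m, of \<Sigma>] add[OF *, of A] under unfolding *(2) w by blast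
    qed
    \<comment> \<open>If only one end of the edge had \<open>F\<close>, then \<open>add\<close> at
      the other end followed by \<open>DS5_down\<close> or \<open>DS5_up\<close> would derive
      \<Gamma>.\<close>
    have "F \<in> label \<Delta> \<longleftrightarrow> F \<in> label \<Theta>"
      if F: "F \<in> {Dia A, BDia A}" and t: "tight \<Sigma>" and \<Gamma>: "\<Gamma> = fill \<Sigma> (add_mset (c \<Theta>) \<Delta>)"
        and c: "c \<in> {White, Black}" for F A \<Sigma> c \<Theta> \<Delta>
    proof -
      obtain \<Sigma>' where \<Sigma>': "tight \<Sigma>'" "\<And>\<Theta>. fill \<Sigma>' \<Theta> = fill \<Sigma> (add_mset (c \<Theta>) \<Delta>)"
        using fill_child[OF t c] by blast
      have label: "label (add_mset (c \<Theta>) \<Delta>) = label \<Delta>"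
        using c by auto
      show ?thesis
      proof
        assume "F \<in> label \<Delta>"
        then have m: "Form F \<in># \<Delta>" by (simp add: label_def)
        show "F \<in> label \<Theta>"
          using DS5_down[OF F c m, of \<Sigma> \<Theta>] add[OF \<Sigma>'(1), of \<Theta> F] inC[OF t \<Gamma>, of F] m under
          by (auto simp: \<Sigma>'(2) \<Gamma>)
      next
        assume "F \<in> label \<Theta>"
        then have m: "Form F \<in># \<Theta>" by (simp add: label_def)
        show "F \<in> label \<Delta>"
          using DS5_up[OF F c m, of \<Sigma> \<Delta>] add[OF t \<Gamma>, of F] inC[OF \<Sigma>'(1), of \<Theta> F] m under
          by (auto simp: \<Sigma>'(2) \<Gamma> label)
      qed
    qed
    note propagated = this
    have root: "F \<in> label \<Gamma> \<longleftrightarrow> F \<in> w" if F: "F \<in> {Dia A, BDia A}" and w: "w \<in> L" for F A w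
    proof -
      obtain \<Sigma> \<Delta> where t: "tight \<Sigma>" and \<Gamma>: "\<Gamma> = fill \<Sigma> \<Delta>" "w = label \<Delta>"
        using w labels_fillE unfolding L_def by blast
      show ?thesis
        unfolding \<Gamma>
      proof (rule propagated_everywhere[OF t])
        fix \<Sigma>' \<Delta>' \<Theta> c
        assume "tight \<Sigma>'" "fill \<Sigma> \<Delta> = fill \<Sigma>' (add_mset (c \<Theta>) \<Delta>')" "c \<in> {White, Black}"
        then show "F \<in> label \<Delta>' \<longleftrightarrow> F \<in> label \<Theta>"
          using propagated[OF F, of \<Sigma>' c \<Theta> \<Delta>'] \<Gamma>(1) by simp
      qed
    qed
    \<comment> \<open>\<open>F\<close> travels from \<open>w\<close> to the root and on to
      \<open>u\<close>, where \<open>free\<close> yields its body.\<close>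
    have diamond: "A \<in> u" if "w \<in> L" "F \<in> w" "F \<in> {Dia A, BDia A}" "u \<in> L" for w A F u
      using free[OF that(4) _ that(3)] root[OF that(3,1)] root[OF that(3,4)] that(2) by blast
    \<comment> \<open>To be refuted, a box needs its body at some node and a diamond needs it at all
      nodes.\<close>
    have truth: "\<not> fm_sat (valuation ` L) A (valuation w)" if "w \<in> L" "A \<in> w" for w A
      using that
    proof (induction A arbitrary: w)
      case (Atom a)
      then show ?case by (simp add: valuation_def)
    next
      case (NAtom a)
      then show ?case using atom[of w a] by (auto simp: valuation_def)
    next
      case (Or A B)
      then show ?case using disj[of w A B] by simp
    next
      case (And A B)
      then show ?case using conj[of w A B] by auto
    next
      case (Box A)
      obtain u where "u \<in> L" "A \<in> u" using box[OF Box.prems] by blast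
      then show ?case using Box.IH[of u] by auto
    next
      case (BBox A)
      obtain u where "u \<in> L" "A \<in> u" using box[OF BBox.prems] by blast
      then show ?case using BBox.IH[of u] by auto
    next
      case (Dia A)
      have "A \<in> u" if "u \<in> L" for u using diamond[OF Dia.prems _ that] by blast
      then show ?case using Dia.IH by simp
    next
      case (BDia A)
      have "A \<in> u" if "u \<in> L" for u using diamond[OF BDia.prems _ that] by blast
      then show ?case using BDia.IH by simp
    qed
    have "\<not> struct_sat (valuation ` L) s (valuation (label \<Gamma>))" if "s \<in># \<Gamma>" for s
    proof (rule struct_sat_countermodel[OF truth])
      show "labels s \<subseteq> L" using that unfolding L_def by auto
      show "label \<Gamma> \<in> L" by (simp add: L_def)
      show "A \<in> label \<Gamma>" if "s = Form A" for A
        using that \<open>s \<in># \<Gamma>\<close> by (simp add: label_def)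
    qed
    moreover have "valuation (label \<Gamma>) \<in> valuation ` L"
      by (simp add: L_def)
    ultimately show False
      using val unfolding valid_def seq_sat_def by blast
  qed
qed

lemma DS5_complete:
  assumes "valid \<Gamma>"
  shows "derivable DS5 \<Gamma>"
proof (rule DS5_complete_over[OF _ _ assms])
  \<comment> \<open>Finiteness bounds the search; closure under subformulas keeps it inside the
    set.\<close>
  let ?C = "\<Union> (subformulas ` \<Union> (labels (White \<Gamma>)))"
  show "finite ?C"
    using finite_labels[of "White \<Gamma>"] finite_subformulas by blast
  show "subformulas A \<subseteq> ?C" if "A \<in> ?C" for A
    using that subformulas_trans by blast
  show "\<Union> (labels (White \<Gamma>)) \<subseteq> ?C"
    using subformulas_refl by blast
qed

theorem theorem5p10:
  fixes \<Gamma> :: "'a sequent"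
  shows "derivable SS5 \<Gamma> \<longleftrightarrow> derivable DS5 \<Gamma>"
  using SS5_sound DS5_complete SS5_if_DS5 by blast

end
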